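(* Let $D$ be the derivation on the ring of Laurent polynomials in the commuting variables $a,x,y,z$ (over $\mathbb{Q}$) determined by $$D(a)=az,\quad D(z)=xy,\quad D(x)=xy,\quad D(y)=xy,$$ extended by linearity and the Leibniz rule $D(uv)=D(u)v+uD(v)$. For such a Laurent polynomial $w$ set $\mathrm{Gen}(w,t)=\sum_{n\ge 0} D^n(w)\,\frac{t^n}{n!}$. Then, as formal power series in $t$, $$\mathrm{Gen}(a,t)=\sum_{n\ge 0} D^n(a)\frac{t^n}{n!}=\frac{a(y-x)e^{zt}}{y e^{xt}-x e^{yt}}.$$
   Context: $D$ is the "formal derivative" associated with the context-free grammar $\{a\to az,\ z\to xy,\ x\to xy,\ y\to xy\}$; $D^0(w)=w$. *)

theory Defs
  imports "HOL-Library.Poly_Mapping" "HOL-Computational_Algebra.Computational_Algebra"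
begin

datatype letter = A | X | Y | Z

text \<open>
  The order on letters has no mathematical role: the library derives that a ring of
  finitely supported functions is an integral domain from a linear order on the exponents.
\<close>

instantiation letter :: linorder
begin

fun letter_rank :: "letter \<Rightarrow> nat" where
  "letter_rank A = 0" | "letter_rank X = 1" | "letter_rank Y = 2" | "letter_rank Z = 3"

definition less_eq_letter :: "letter \<Rightarrow> letter \<Rightarrow> bool" where
  "less_eq_letter u v \<longleftrightarrow> letter_rank u \<le> letter_rank v"

definition less_letter :: "letter \<Rightarrow> letter \<Rightarrow> bool" where
  "less_letter u v \<longleftrightarrow> letter_rank u < letter_rank v"

instance
proof
  fix u v :: letter
  assume "u \<le> v" "v \<le> u"
  then show "u = v" by (cases u; cases v; simp add: less_eq_letter_def)
qed (auto simp: less_eq_letter_def less_letter_def)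

end

text \<open>
  A Laurent monomial is its exponent vector in \<open>letter \<Rightarrow>\<^sub>0 int\<close>; Laurent polynomials over the
  rationals are the group algebra of the exponent vectors, multiplication being convolution.
\<close>

type_synonym laurent = "(letter \<Rightarrow>\<^sub>0 int) \<Rightarrow>\<^sub>0 rat"

definition lvar :: "letter \<Rightarrow> laurent" where
  "lvar v = Poly_Mapping.single (Poly_Mapping.single v 1) 1"

definition lconst :: "rat \<Rightarrow> laurent" where
  "lconst c = Poly_Mapping.single 0 c"

abbreviation va :: laurent where "va \<equiv> lvar A"
abbreviation vx :: laurent where "vx \<equiv> lvar X"
abbreviation vy :: laurent where "vy \<equiv> lvar Y"
abbreviation vz :: laurent where "vz \<equiv> lvar Z"

definition is_derivation :: "(laurent \<Rightarrow> laurent) \<Rightarrow> bool" where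
  "is_derivation D \<longleftrightarrow>
     (\<forall>u v. D (u + v) = D u + D v) \<and>
     (\<forall>c u. D (lconst c * u) = lconst c * D u) \<and>
     (\<forall>u v. D (u * v) = D u * v + u * D v)"

definition grammar_derivation :: "(laurent \<Rightarrow> laurent) \<Rightarrow> bool" where
  "grammar_derivation D \<longleftrightarrow> is_derivation D \<and>
     D va = va * vz \<and> D vz = vx * vy \<and> D vx = vx * vy \<and> D vy = vx * vy"

definition Gen :: "(laurent \<Rightarrow> laurent) \<Rightarrow> laurent \<Rightarrow> laurent fps" where
  "Gen D w = Abs_fps (\<lambda>n. lconst (1 / fact n) * (D ^^ n) w)"

lemma Gen_sums:
  "(\<lambda>N. \<Sum>n=0..N. fps_const (lconst (1 / fact n) * (D ^^ n) w) * fps_X ^ n) \<longlonglongrightarrow> Gen D w"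
  using fps_notation[of "Gen D w"] by (simp add: Gen_def)

text \<open>
  The constant term \<open>y - x\<close> of the denominator \<open>y e\<^sup>x\<^sup>t - x e\<^sup>y\<^sup>t\<close> is not a unit of the Laurent
  polynomial ring, so the quotient is formed over the field of fractions.
\<close>

definition to_frac :: "laurent \<Rightarrow> laurent fract" where
  "to_frac u = Fraction_Field.Fract u 1"

definition fps_to_frac :: "laurent fps \<Rightarrow> laurent fract fps" where
  "fps_to_frac F = Abs_fps (\<lambda>n. to_frac (fps_nth F n))"

instance fract :: ("{idom, ring_char_0}") field_char_0
proof
  have "(of_nat n :: 'a fract) = Fraction_Field.Fract (of_nat n) 1" for n
    by (induction n) (simp_all add: Zero_fract_def One_fract_def)
  then show "inj (of_nat :: nat \<Rightarrow> 'a fract)"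
    by (auto intro!: injI simp: eq_fract)
qed

lemma to_frac_eq_iff: "to_frac u = to_frac v \<longleftrightarrow> u = v"
  by (simp add: to_frac_def eq_fract)

lemma lvar_eq_iff: "lvar u = lvar v \<longleftrightarrow> u = v"
proof
  assume "lvar u = lvar v"
  then have "Poly_Mapping.lookup (lvar u) (Poly_Mapping.single v 1) = 1"
    by (simp add: lvar_def)
  then have "Poly_Mapping.single u (1::int) = Poly_Mapping.single v 1"
    by (simp add: lvar_def lookup_single when_def split: if_splits)
  then have "Poly_Mapping.lookup (Poly_Mapping.single u (1::int)) v = 1"
    by simp
  then show "u = v"
    by (simp add: lookup_single when_def split: if_splits)
qed simp

lemma denominator_unit:
  "fps_nth (fps_const (to_frac vy) * fps_exp (to_frac vx) -
            fps_const (to_frac vx) * fps_exp (to_frac vy)) 0 \<noteq> 0"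
  by (simp add: to_frac_eq_iff lvar_eq_iff)

text \<open>The four values on the letters determine a derivation, and it exists.\<close>

lemma laurent_induct [case_names single add]:
  fixes f :: "'k \<Rightarrow>\<^sub>0 'b::comm_monoid_add"
  assumes single: "\<And>k c. P (Poly_Mapping.single k c)"
    and add: "\<And>f g. P f \<Longrightarrow> P g \<Longrightarrow> P (f + g)"
  shows "P f"
proof (induction f rule: update_induct)
  case const
  have "P (Poly_Mapping.single undefined 0)" by (rule single)
  then show ?case by simp
next
  case (update f a b)
  have "Poly_Mapping.update a b f = f + Poly_Mapping.single a b"
    using update by (intro poly_mapping_eqI)
      (auto simp: lookup_update lookup_add lookup_single in_keys_iff)
  with update single add show ?case by simp
qed

lift_definition euler :: "letter \<Rightarrow> laurent \<Rightarrow> laurent" is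
  "\<lambda>v f m. of_int (Poly_Mapping.lookup m v) * f m"
  by (erule rev_finite_subset) auto

lemma euler_add: "euler v (f + g) = euler v f + euler v g"
  by transfer (simp add: distrib_left)

lemma euler_single:
  "euler v (Poly_Mapping.single m c) = lconst (of_int (Poly_Mapping.lookup m v)) * Poly_Mapping.single m c"
  unfolding lconst_def mult_single
  by (rule poly_mapping_eqI) (simp add: euler.rep_eq lookup_single when_def)

lemma euler_mult: "euler v (f * g) = euler v f * g + f * euler v g"
proof (induction f rule: laurent_induct)
  case (single k c)
  show ?case
  proof (induction g rule: laurent_induct)
    case (single l d)
    then show ?case
      by (simp add: mult_single euler_single lookup_add lconst_def algebra_simps
          del: single_of_int flip: single_add)
  next
    case (add f g)
    then show ?case by (simp add: euler_add algebra_simps)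
  qed
next
  case (add f g)
  then show ?case by (simp add: euler_add algebra_simps)
qed

lemma euler_lconst: "euler v (lconst c) = 0"
  by (simp add: lconst_def euler_single)

lemma euler_lvar: "euler v (lvar w) = (if v = w then lvar w else 0)"
  by (simp add: lvar_def euler_single lconst_def lookup_single when_def mult_single)

lemma grammar_derivation_exists: "\<exists>D. grammar_derivation D"
proof
  define zi :: laurent where "zi = Poly_Mapping.single (Poly_Mapping.single Z (-1)) 1"
  have zi: "vz * zi = 1"
    by (simp add: zi_def lvar_def mult_single flip: single_add)
  define D where "D u = euler A u * vz + euler X u * vy + euler Y u * vx
                          + euler Z u * (zi * (vx * vy))" for u
  have "D (u + v) = D u + D v" for u v
    by (simp add: D_def euler_add algebra_simps)
  moreover have "D (u * v) = D u * v + u * D v" for u v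
    by (simp add: D_def euler_mult algebra_simps)
  moreover have "D (lconst c * u) = lconst c * D u" for c u
    by (simp add: D_def euler_mult euler_lconst algebra_simps)
  moreover have "D va = va * vz" "D vx = vx * vy" "D vy = vx * vy"
    by (simp_all add: D_def euler_lvar mult.commute)
  moreover have "D vz = vx * vy"
    using zi by (simp add: D_def euler_lvar flip: mult.assoc)
  ultimately show "grammar_derivation D"
    by (simp add: grammar_derivation_def is_derivation_def)
qed

lemma derivation_unique:
  assumes D: "is_derivation D" and E: "is_derivation E" and eq: "\<And>v. D (lvar v) = E (lvar v)"
  shows "D = E"
proof
  define d where "d u = D u - E u" for u
  have add: "d (u + v) = d u + d v" and mult: "d (u * v) = d u * v + u * d v"
    and scale: "d (lconst c * u) = lconst c * d u" for u v c
    using D E by (auto simp: d_def is_derivation_def algebra_simps)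
  have "d (1 * 1) = d 1 * 1 + 1 * d 1" by (rule mult)
  then have one: "d 1 = 0" by simp
  define P where "P m \<longleftrightarrow> d (Poly_Mapping.single m 1) = 0" for m
  have P_add: "P (k + l)" if "P k" "P l" for k l
  proof -
    have "Poly_Mapping.single (k + l) (1::rat) = Poly_Mapping.single k 1 * Poly_Mapping.single l 1"
      by (simp add: mult_single)
    then show ?thesis using that by (simp add: P_def mult)
  qed
  have P_uminus: "P (- k)" if "P k" for k
  proof -
    have e: "Poly_Mapping.single k (1::rat) * Poly_Mapping.single (- k) 1 = 1"
      by (simp add: mult_single)
    then have "Poly_Mapping.single k 1 * d (Poly_Mapping.single (- k) 1) = 0"
      using mult[of "Poly_Mapping.single k 1" "Poly_Mapping.single (- k) 1"] one that
      by (simp add: P_def)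
    moreover have "Poly_Mapping.single k (1::rat) \<noteq> 0"
      using e by force
    ultimately show ?thesis by (simp add: P_def)
  qed
  have P0: "P 0" using one by (simp add: P_def)
  have Pn: "P (Poly_Mapping.single v (int n))" for v n
  proof (induction n)
    case (Suc n)
    have "P (Poly_Mapping.single v 1)"
      using eq by (simp add: P_def d_def flip: lvar_def)
    from P_add[OF this Suc] show ?case by (simp flip: single_add)
  qed (use P0 in simp)
  have P: "P m" for m
  proof (induction m rule: laurent_induct)
    case (single v k)
    show ?case
    proof (cases k rule: int_cases2)
      case (nonneg n)
      then show ?thesis using Pn by simp
    next
      case (nonpos n)
      then show ?thesis using P_uminus[OF Pn[of v n]] by (simp add: single_uminus)
    qed
  qed (rule P_add)
  fix u
  have "d u = 0"
  proof (induction u rule: laurent_induct)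
    case (single m c)
    have "Poly_Mapping.single m c = lconst c * Poly_Mapping.single m 1"
      by (simp add: lconst_def mult_single)
    then show ?case using P[of m] by (simp add: scale P_def)
  qed (simp add: add)
  then show "D u = E u" by (simp add: d_def)
qed

lemma grammar_derivation_unique: "\<exists>!D. grammar_derivation D"
proof (rule ex_ex1I)
  fix D E assume DE: "grammar_derivation D" "grammar_derivation E"
  have "D (lvar v) = E (lvar v)" for v
    using DE by (cases v) (auto simp: grammar_derivation_def)
  then show "D = E"
    using DE by (intro derivation_unique) (auto simp: grammar_derivation_def)
qed (rule grammar_derivation_exists)

end

theory Submission
  imports Defs
begin

text \<open>
  Over the fraction field, \<open>Gen\<close> is a ring homomorphism, and \<open>Gen(w) = w e\<^sup>k\<^sup>t\<close> whenever
  \<open>D w = k w\<close> with \<open>D k = 0\<close>. Since \<open>y - x\<close> and \<open>z - x\<close> are constants of \<open>D\<close>, both \<open>y/x\<close> and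
  \<open>a/x\<close> are such eigenvectors, with eigenvalues \<open>x - y\<close> and \<open>z - y\<close>. Hence
  \<open>Gen(x) (Gen(y/x) - 1) = Gen(y) - Gen(x) = y - x\<close> determines \<open>Gen(x)\<close>, and
  \<open>Gen(a) = Gen(x) Gen(a/x)\<close>.
\<close>

lemma to_frac_add: "to_frac (u + v) = to_frac u + to_frac v"
  by (simp add: to_frac_def)

lemma to_frac_mult: "to_frac (u * v) = to_frac u * to_frac v"
  by (simp add: to_frac_def)

lemma to_frac_0: "to_frac 0 = 0"
  by (simp add: to_frac_def Zero_fract_def)

lemma to_frac_1: "to_frac 1 = 1"
  by (simp add: to_frac_def One_fract_def)

lemma to_frac_of_nat: "to_frac (of_nat n) = of_nat n"
  by (induction n) (simp_all add: to_frac_0 to_frac_1 to_frac_add)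

lemma to_frac_power: "to_frac (u ^ n) = to_frac u ^ n"
  by (induction n) (simp_all add: to_frac_1 to_frac_mult)

text \<open>Multiplying by \<open>n!\<close> gives 1 already among the Laurent polynomials; in the
  fraction field, of characteristic 0, this determines the value.\<close>

lemma to_frac_lconst_inverse_fact: "to_frac (lconst (1 / fact n)) = 1 / fact n"
proof -
  have "lconst (1 / fact n) * of_nat (fact n) = lconst (1 / fact n) * lconst (of_nat (fact n))"
    by (simp only: lconst_def single_of_nat)
  also have "\<dots> = 1"
    by (simp add: lconst_def mult_single)
  finally have "to_frac (lconst (1 / fact n) * of_nat (fact n)) = 1"
    by (simp add: to_frac_1)
  then have "to_frac (lconst (1 / fact n)) * fact n = 1"
    by (metis to_frac_mult to_frac_of_nat of_nat_fact)
  then show ?thesis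
    by (simp add: field_simps)
qed

lemma fps_to_frac_Gen_nth: "fps_nth (fps_to_frac (Gen D w)) n = to_frac ((D ^^ n) w) / fact n"
  by (simp add: fps_to_frac_def Gen_def to_frac_mult to_frac_lconst_inverse_fact)

text \<open>The factor \<open>n + 1\<close> produced by \<open>fps_deriv\<close> cancels against
  \<open>fact (Suc n)\<close>, leaving one extra application of \<open>D\<close>.\<close>

lemma fps_deriv_Gen: "fps_deriv (fps_to_frac (Gen D w)) = fps_to_frac (Gen D (D w))"
proof (rule fps_ext)
  fix n
  have "(D ^^ Suc n) w = (D ^^ n) (D w)"
    by (simp add: funpow_swap1)
  then show "fps_nth (fps_deriv (fps_to_frac (Gen D w))) n
      = fps_nth (fps_to_frac (Gen D (D w))) n"
    by (simp only: fps_deriv_nth fps_to_frac_Gen_nth Suc_eq_plus1[symmetric] fact_Suc)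
       (simp del: of_nat_Suc)
qed

lemma Gen_add:
  assumes "is_derivation D"
  shows "fps_to_frac (Gen D (u + v)) = fps_to_frac (Gen D u) + fps_to_frac (Gen D v)"
proof -
  have "D (u + v) = D u + D v" for u v
    using assms by (simp only: is_derivation_def)
  then have "(D ^^ n) (u + v) = (D ^^ n) u + (D ^^ n) v" for n
    by (induction n) simp_all
  then show ?thesis
    by (intro fps_ext) (simp add: fps_to_frac_Gen_nth to_frac_add add_divide_distrib)
qed

text \<open>Both sides have the same constant term and satisfy the same recursion under \<open>d/dt\<close>.\<close>

lemma Gen_mult:
  assumes "is_derivation D"
  shows "fps_to_frac (Gen D (u * v)) = fps_to_frac (Gen D u) * fps_to_frac (Gen D v)"
proof (rule fps_ext)
  let ?G = "\<lambda>w. fps_to_frac (Gen D w)"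
  fix n
  show "fps_nth (?G (u * v)) n = fps_nth (?G u * ?G v) n"
  \<comment> \<open>The Leibniz rule calls for the induction hypothesis at the pairs
    \<open>D u\<close>, \<open>v\<close> and \<open>u\<close>, \<open>D v\<close>.\<close>
  proof (induction n arbitrary: u v)
    case 0
    show ?case by (simp add: fps_to_frac_Gen_nth to_frac_mult)
  next
    case (Suc n)
    have "of_nat (Suc n) * fps_nth (?G (u * v)) (Suc n) = fps_nth (?G (D (u * v))) n"
      by (simp flip: fps_deriv_Gen)
    also have "D (u * v) = D u * v + u * D v"
      using assms by (simp add: is_derivation_def)
    also have "fps_nth (?G (D u * v + u * D v)) n
        = fps_nth (fps_deriv (?G u) * ?G v + ?G u * fps_deriv (?G v)) n"
      by (simp add: Gen_add[OF assms] Suc fps_deriv_Gen)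
    also have "\<dots> = fps_nth (fps_deriv (?G u * ?G v)) n"
      by (simp add: algebra_simps)
    also have "\<dots> = of_nat (Suc n) * fps_nth (?G u * ?G v) (Suc n)"
      by (simp only: fps_deriv_nth Suc_eq_plus1)
    finally show ?case
      by (simp only: mult_cancel_left of_nat_eq_0_iff) simp
  qed
qed

text \<open>Since \<open>D k = 0\<close>, powers of \<open>k\<close> pass through \<open>D\<close>,
  so that \<open>(D ^^ n) w = k ^ n * w\<close>.\<close>

lemma Gen_eigenvector:
  assumes D: "is_derivation D" and k: "D k = 0" and w: "D w = k * w"
  shows "fps_to_frac (Gen D w) = fps_const (to_frac w) * fps_exp (to_frac k)"
proof -
  have mult: "D (u * v) = D u * v + u * D v" for u v
    using D by (simp add: is_derivation_def)
  have kn: "D (k ^ n * u) = k ^ n * D u" for n u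
    by (induction n) (simp_all add: mult k mult.assoc)
  have "(D ^^ n) w = k ^ n * w" for n
    by (induction n) (simp_all add: kn w mult.assoc mult.left_commute)
  then show ?thesis
    by (intro fps_ext) (simp add: fps_to_frac_Gen_nth to_frac_mult to_frac_power)
qed

lemma Gen_constant:
  assumes "is_derivation D" "D k = 0"
  shows "fps_to_frac (Gen D k) = fps_const (to_frac k)"
proof -
  have "D 0 = 0"
    using assms by (metis add_cancel_left_left is_derivation_def)
  then show ?thesis
    using Gen_eigenvector[of D 0 k] assms by (simp add: to_frac_0)
qed

theorem theorem2p2:
  fixes D :: "laurent \<Rightarrow> laurent"
  assumes "grammar_derivation D"
  shows "fps_to_frac (Gen D va) =
           fps_const (to_frac (va * (vy - vx))) * fps_exp (to_frac vz) /
           (fps_const (to_frac vy) * fps_exp (to_frac vx) -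
            fps_const (to_frac vx) * fps_exp (to_frac vy))"
proof -
  let ?G = "\<lambda>w. fps_to_frac (Gen D w)"
  let ?c = "\<lambda>w. fps_const (to_frac w)"
  let ?E = "\<lambda>w. fps_exp (to_frac w)"
  let ?den = "?c vy * ?E vx - ?c vx * ?E vy"
  have D: "is_derivation D"
    and gens: "D va = va * vz" "D vz = vx * vy" "D vx = vx * vy" "D vy = vx * vy"
    using assms by (auto simp: grammar_derivation_def)
  have mult: "D (u * v) = D u * v + u * D v" and add: "D (u + v) = D u + D v" for u v
    using D by (auto simp: is_derivation_def)
  have diff: "D (u - v) = D u - D v" for u v
    using add[of "u - v" v] by simp
  \<comment> \<open>The inverse of \<open>vx\<close>, so that y/x and a/x are themselves Laurent
    polynomials.\<close>
  define xi :: laurent where "xi = Poly_Mapping.single (Poly_Mapping.single X (-1)) 1"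
  have xi: "vx * xi = 1"
    by (simp add: xi_def lvar_def mult_single flip: single_add)
  have "D 1 = 0"
    using mult[of 1 1] by simp
  then have "xi * (vx * vy * xi + vx * D xi) = 0"
    using mult[of vx xi] xi by (simp add: gens)
  then have "(vx * xi) * (vy * xi) + (vx * xi) * D xi = 0"
    by (simp add: algebra_simps)
  then have Dxi: "D xi = - (vy * xi)"
    by (simp add: xi add_eq_0_iff)
  have Gyx: "?G (vy * xi) = ?c (vy * xi) * ?E (vx - vy)"
    by (rule Gen_eigenvector[OF D]) (simp_all add: mult diff gens Dxi algebra_simps)
  have Gax: "?G (va * xi) = ?c (va * xi) * ?E (vz - vy)"
    by (rule Gen_eigenvector[OF D]) (simp_all add: mult diff gens Dxi algebra_simps)
  have x_cancel: "vx * (u * xi) = u" for u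
    using xi by (simp add: algebra_simps)
  have Ga: "?G va = ?G vx * ?G (va * xi)"
    by (simp add: x_cancel flip: Gen_mult[OF D])
  \<comment> \<open>The product x (y/x) = y is written as x + (y - x) to bring in the constant y - x
    of \<open>D\<close>.\<close>
  have "?G vx * ?G (vy * xi) = ?G (vx + (vy - vx))"
    by (simp add: x_cancel flip: Gen_mult[OF D])
  also have "\<dots> = ?G vx + ?c (vy - vx)"
    using Gen_constant[OF D, of "vy - vx"] by (simp only: Gen_add[OF D] diff gens) simp
  finally have Gx: "?G vx * (?G (vy * xi) - 1) = ?c (vy - vx)"
    by (simp add: algebra_simps)
  have c_mult: "?c (u * v) = ?c u * ?c v" for u v
    by (simp add: to_frac_mult)
  have E_add: "?E (u + v) = ?E u * ?E v" for u v
    by (simp add: to_frac_add fps_exp_add_mult)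
  \<comment> \<open>Writing y as x (y/x) and the exponent x as y + (x - y) exposes the factor
    \<open>?c vx * ?E vy\<close>, which the numerator below shares.\<close>
  have "?c vy * ?E vx = ?c (vx * (vy * xi)) * ?E (vy + (vx - vy))"
    by (simp add: x_cancel)
  then have den: "?den = ?c vx * ?E vy * (?G (vy * xi) - 1)"
    unfolding c_mult[of vx] E_add Gyx by (simp only: right_diff_distrib mult_1_left mult_1_right mult_ac)
  have "?c va * ?E vz = ?c (vx * (va * xi)) * ?E (vy + (vz - vy))"
    by (simp add: x_cancel)
  then have num: "?c va * ?E vz = ?c vx * ?E vy * ?G (va * xi)"
    unfolding c_mult[of vx] E_add Gax by (simp only: algebra_simps)
  have "?G va * ?den = (?c vx * ?E vy * ?G (va * xi)) * (?G vx * (?G (vy * xi) - 1))"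
    by (simp only: Ga den mult_ac)
  also have "\<dots> = ?c (va * (vy - vx)) * ?E vz"
    unfolding num[symmetric] Gx c_mult by (simp only: mult_ac)
  finally have eq: "?G va * ?den = ?c (va * (vy - vx)) * ?E vz" .
  \<comment> \<open>The constant term y - x is nonzero, so \<open>?den\<close> can be cancelled in
    the quotient.\<close>
  have "?den \<noteq> 0"
    using denominator_unit by (metis fps_zero_nth)
  then show ?thesis
    unfolding eq[symmetric] by simp
qed

end
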